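(* Let $A\in\mathbb{C}^{m\times n}$, $B\in\mathbb{C}^{m\times p}$, $D\in\mathbb{C}^{p\times q}$, $E\in\mathbb{C}^{n\times q}$, and let $A^{(1)}$, $D^{(1)}$ be $\{1\}$-inverses of $A$ and $D$. Suppose that the matrix system $$AX=B\quad\wedge\quad XD=E$$ in the unknown $X\in\mathbb{C}^{n\times p}$ is consistent. Then its general reproductive solution is given by the formula $$X=f(Y)=A^{(1)}B+ED^{(1)}-A^{(1)}AED^{(1)}+(I-A^{(1)}A)Y(I-DD^{(1)}),$$ where $Y\in\mathbb{C}^{n\times p}$ is an arbitrary matrix. Moreover, if $X_0$ is a particular solution of the system with $X_0\neq X_1$, where $X_1=A^{(1)}B+ED^{(1)}-A^{(1)}AED^{(1)}$, then $$X=g(Y)=X_0+(I-A^{(1)}A)Y(I-DD^{(1)}),\qquad Y\in\mathbb{C}^{n\times p}\text{ arbitrary},$$ is a general non-reproductive solution of the system.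
   Context: A $\{1\}$-inverse of a matrix $M\in\mathbb{C}^{m\times n}$ is any matrix $M^{(1)}\in\mathbb{C}^{n\times m}$ with $MM^{(1)}M=M$. For a function $\phi:S\to S$ (here $S=\mathbb{C}^{n\times p}$), the formula $x=\phi(t)$ represents the general solution of an equation or system $J(x)$ if $J(\phi(t))$ holds for every $t\in S$ and every solution $x$ equals $\phi(t)$ for some $t\in S$. It represents the reproductive general solution if $J(\phi(t))$ holds for every $t\in S$ and $\phi(t)=t$ for every solution $t$ of $J$. A general solution that is not reproductive is called a general non-reproductive solution. A system is consistent if it has at least one solution. *)

theory Defs
  imports "HOL-Analysis.Analysis"
begin

(* An m x n matrix is an element of complex^'n^'m: the column index type comes first. *)

definition is_1_inverse :: "complex^'n^'m \<Rightarrow> complex^'m^'n \<Rightarrow> bool" where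
  "is_1_inverse M G \<longleftrightarrow> M ** G ** M = M"

(* An equation or system in an unknown x ranging over the type 'a (the set S)
   is represented by its solution predicate J. *)

definition consistent :: "('a \<Rightarrow> bool) \<Rightarrow> bool" where
  "consistent J \<longleftrightarrow> (\<exists>x. J x)"

definition general_solution :: "('a \<Rightarrow> bool) \<Rightarrow> ('a \<Rightarrow> 'a) \<Rightarrow> bool" where
  "general_solution J \<phi> \<longleftrightarrow> (\<forall>t. J (\<phi> t)) \<and> (\<forall>x. J x \<longrightarrow> (\<exists>t. x = \<phi> t))"

definition reproductive_general_solution :: "('a \<Rightarrow> bool) \<Rightarrow> ('a \<Rightarrow> 'a) \<Rightarrow> bool" where
  "reproductive_general_solution J \<phi> \<longleftrightarrow> (\<forall>t. J (\<phi> t)) \<and> (\<forall>t. J t \<longrightarrow> \<phi> t = t)"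

definition nonreproductive_general_solution :: "('a \<Rightarrow> bool) \<Rightarrow> ('a \<Rightarrow> 'a) \<Rightarrow> bool" where
  "nonreproductive_general_solution J \<phi> \<longleftrightarrow>
     general_solution J \<phi> \<and> \<not> reproductive_general_solution J \<phi>"

definition matrix_system ::
  "complex^'n^'m \<Rightarrow> complex^'p^'m \<Rightarrow> complex^'q^'p \<Rightarrow> complex^'q^'n \<Rightarrow> complex^'p^'n \<Rightarrow> bool" where
  "matrix_system A B D E X \<longleftrightarrow> A ** X = B \<and> X ** D = E"

end

theory Submission
  imports Defs
begin

text \<open>
  Write \<open>P = I - A\<^sub>1A\<close>, \<open>Q = I - DD\<^sub>1\<close> and
  \<open>X\<^sub>1 = A\<^sub>1B + ED\<^sub>1 - A\<^sub>1AED\<^sub>1\<close>. The defining equations of the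
  \<open>{1}\<close>-inverses \<open>A\<^sub>1\<close> and \<open>D\<^sub>1\<close> say that \<open>AP = 0\<close>
  and \<open>QD = 0\<close>, so every \<open>PYQ\<close> solves the homogeneous system and adding it to a solution gives a solution (\<open>solution_plus_sandwich\<close>).

  Conversely, expanding \<open>PXQ\<close> for a solution \<open>X\<close> and replacing \<open>AX\<close> by \<open>B\<close> and \<open>XD\<close> by \<open>E\<close>
  gives \<open>X = X\<^sub>1 + PXQ\<close> (\<open>solution_decomposition\<close>). This one identity carries the rest.
  As \<open>X\<^sub>1 = X + P(-X)Q\<close>, consistency makes \<open>X\<^sub>1\<close> itself a solution; the formula
  \<open>f(Y) = X\<^sub>1 + PYQ\<close> fixes every solution; and \<open>P(X - X\<^sub>0)Q = X - X\<^sub>0\<close> for any two solutions, so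
  \<open>g(Y) = X\<^sub>0 + PYQ\<close> attains \<open>X\<close> at
  \<open>Y = X - X\<^sub>0\<close>. Finally \<open>g(X\<^sub>0) = X\<^sub>0 + (X\<^sub>0 - X\<^sub>1)\<close>, so \<open>g\<close> moves the solution \<open>X\<^sub>0\<close>
  as soon as \<open>X\<^sub>0\<close> differs from \<open>X\<^sub>1\<close>.
\<close>

lemma matrix_add_rdistrib:
  fixes A B :: "'a::semiring_1^'n^'m"
  shows "(A + B) ** C = A ** C + B ** C"
  by (simp add: matrix_matrix_mult_def vec_eq_iff distrib_right sum.distrib)

lemma matrix_sub_ldistrib:
  fixes A :: "'a::ring_1^'n^'m"
  shows "A ** (B - C) = A ** B - A ** C"
  by (simp add: matrix_matrix_mult_def vec_eq_iff right_diff_distrib sum_subtractf)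

lemma matrix_sub_rdistrib:
  fixes A B :: "'a::ring_1^'n^'m"
  shows "(A - B) ** C = A ** C - B ** C"
  by (simp add: matrix_matrix_mult_def vec_eq_iff left_diff_distrib sum_subtractf)

lemma solution_plus_sandwich:
  assumes "is_1_inverse A A1" and "is_1_inverse D D1"
    and "matrix_system A B D E X"
  shows "matrix_system A B D E (X + (mat 1 - A1 ** A) ** Y ** (mat 1 - D ** D1))"
proof -
  have "A ** (mat 1 - A1 ** A) = 0"
    using assms(1) by (simp add: is_1_inverse_def matrix_sub_ldistrib matrix_mul_assoc)
  hence "A ** ((mat 1 - A1 ** A) ** Y ** (mat 1 - D ** D1)) = 0"
    by (simp add: matrix_mul_assoc)
  moreover have "(mat 1 - D ** D1) ** D = 0"
    using assms(2) by (simp add: is_1_inverse_def matrix_sub_rdistrib)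
  hence "(mat 1 - A1 ** A) ** Y ** (mat 1 - D ** D1) ** D = 0"
    by (simp flip: matrix_mul_assoc)
  ultimately show ?thesis
    using assms(3) by (simp add: matrix_system_def matrix_add_ldistrib matrix_add_rdistrib)
qed

text \<open>
  Expanding the triple product gives four terms; the equations of the system turn the three of
  them other than \<open>X\<close> into known data.
\<close>

lemma solution_decomposition:
  assumes "matrix_system A B D E X"
  shows "X = A1 ** B + E ** D1 - A1 ** A ** E ** D1
               + (mat 1 - A1 ** A) ** X ** (mat 1 - D ** D1)"
proof -
  have B: "B = A ** X" and E: "E = X ** D"
    using assms by (simp_all add: matrix_system_def)
  show ?thesis
    unfolding B E
    by (simp add: matrix_sub_ldistrib matrix_sub_rdistrib matrix_mul_assoc)
qed

theorem mainTheorem5: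
  fixes A :: "complex^'n^'m" and B :: "complex^'p^'m"
    and D :: "complex^'q^'p" and E :: "complex^'q^'n"
    and A1 :: "complex^'m^'n" and D1 :: "complex^'p^'q"
  assumes "is_1_inverse A A1" and "is_1_inverse D D1"
    and "consistent (matrix_system A B D E)"
  shows "reproductive_general_solution (matrix_system A B D E)
           (\<lambda>Y. A1 ** B + E ** D1 - A1 ** A ** E ** D1
                 + (mat 1 - A1 ** A) ** Y ** (mat 1 - D ** D1))
       \<and> (\<forall>X0. matrix_system A B D E X0
             \<and> X0 \<noteq> A1 ** B + E ** D1 - A1 ** A ** E ** D1
           \<longrightarrow> nonreproductive_general_solution (matrix_system A B D E)
                 (\<lambda>Y. X0 + (mat 1 - A1 ** A) ** Y ** (mat 1 - D ** D1)))"
proof -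
  let ?J = "matrix_system A B D E"
  define X1 where "X1 = A1 ** B + E ** D1 - A1 ** A ** E ** D1"
  define S where "S Y = (mat 1 - A1 ** A) ** Y ** (mat 1 - D ** D1)" for Y
  have S_diff: "S (Y - Z) = S Y - S Z" for Y Z
    by (simp add: S_def matrix_sub_ldistrib matrix_sub_rdistrib)
  have plus: "?J (X + S Y)" if "?J X" for X Y
    unfolding S_def using assms(1,2) that by (rule solution_plus_sandwich)
  have decomp: "X = X1 + S X" if "?J X" for X
    unfolding X1_def S_def using that by (rule solution_decomposition)
  obtain X where X: "?J X"
    using assms(3) by (auto simp: consistent_def)
  have "S (0 - X) = - S X"
    unfolding S_diff by (simp add: S_def)
  hence "X1 = X + S (0 - X)"
    using decomp[OF X] by (simp add: eq_diff_eq)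
  hence X1: "?J X1"
    using plus[OF X] by simp
  have "reproductive_general_solution ?J (\<lambda>Y. X1 + S Y)"
    using plus[OF X1] decomp by (simp add: reproductive_general_solution_def)
  moreover have "nonreproductive_general_solution ?J (\<lambda>Y. X0 + S Y)"
    if X0: "?J X0" and ne: "X0 \<noteq> X1" for X0
  proof -
    have "Z = X0 + S (Z - X0)" if "?J Z" for Z
    proof -
      have "S Z = Z - X1" and "S X0 = X0 - X1"
        using decomp[OF that] decomp[OF X0] by (simp_all add: eq_diff_eq add.commute)
      thus ?thesis
        by (simp add: S_diff)
    qed
    hence "general_solution ?J (\<lambda>Y. X0 + S Y)"
      using plus[OF X0] by (auto simp: general_solution_def)
    moreover have "S X0 \<noteq> 0"
      using decomp[OF X0] ne by auto
    hence "\<not> reproductive_general_solution ?J (\<lambda>Y. X0 + S Y)"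
      using X0 by (auto simp: reproductive_general_solution_def)
    ultimately show ?thesis
      by (simp add: nonreproductive_general_solution_def)
  qed
  ultimately show ?thesis
    unfolding X1_def S_def by blast
qed

end
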